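(* For all integers $n\ge 1$ and $k\ge 0$, the over-Mahonian number $i_{B'}(n,k)$ equals the number of overpartitions (of any weight) into exactly $k$ parts, with all parts at most $n-1$, such that for each $j$ the non-overlined part $j$ appears at most $j$ times if the overpartition has no overlined part $\overline{j}$, and at most $j-1$ times if the overpartition has an overlined part $\overline{j}$.
   Context: For $n\ge 1$, $B'_n$ denotes the set of overlined permutations of $\{1,\dots,n\}$ of the following kind: an element is a permutation $\sigma=\sigma_1\sigma_2\cdots\sigma_n$ of $\{1,\dots,n\}$ (in one-line notation) in which each entry $\sigma_i$ is independently either overlined or not overlined, subject to the condition that $\sigma_i$ may be overlined only if there is an index $j>i$ with $\sigma_i>\sigma_j$ (overlines are ignored in comparing entries). An inversion of such an element is a pair of positions $i<j$ with $\sigma_i>\sigma_j$, again ignoring overlines. The over-Mahonian number $i_{B'}(n,k)$ is the number of elements of $B'_n$ with exactly $k$ inversions; it is $0$ for integers $k$ outside $0\le k\le\binom n2$. An overpartition is a non-increasing finite sequence of positive integers (its parts) in which the first occurrence of each number may be overlined or not; thus each value $j$ has at most one overlined copy $\overline{j}$. The number of parts counts all parts, overlined and non-overlined. The empty overpartition is the only one with $0$ parts. *)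

theory Defs
  imports Main "HOL-Combinatorics.Multiset_Permutations"
begin

text \<open>An entry of an overlined word is a pair: its numerical value, and a flag that is
  \<^const>\<open>True\<close> iff the entry is overlined. List positions are counted from 0.\<close>

type_synonym entry = "nat \<times> bool"

definition overlined_perms :: "nat \<Rightarrow> entry list set" where
  "overlined_perms n =
     {w. map fst w \<in> permutations_of_set {1..n} \<and>
         (\<forall>i<length w. snd (w ! i) \<longrightarrow> (\<exists>j. i < j \<and> j < length w \<and> fst (w ! i) > fst (w ! j)))}"

definition inversions :: "entry list \<Rightarrow> (nat \<times> nat) set" where
  "inversions w = {(i, j). i < j \<and> j < length w \<and> fst (w ! i) > fst (w ! j)}"

definition over_mahonian :: "nat \<Rightarrow> nat \<Rightarrow> nat" where
  "over_mahonian n k = card {w \<in> overlined_perms n. card (inversions w) = k}"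

text \<open>The last conjunct says that an overlined part is the first occurrence of its value.\<close>

definition overpartition :: "entry list \<Rightarrow> bool" where
  "overpartition p \<longleftrightarrow>
     (\<forall>x\<in>set p. fst x > 0) \<and>
     sorted_wrt (\<ge>) (map fst p) \<and>
     (\<forall>i<length p. snd (p ! i) \<longrightarrow> (\<forall>i'<i. fst (p ! i') \<noteq> fst (p ! i)))"

text \<open>The sets whose cardinalities are taken are finite, so that \<^const>\<open>card\<close> really counts them.\<close>

lemma finite_overlined_perms: "finite (overlined_perms n)"
proof (rule finite_subset)
  show "overlined_perms n \<subseteq> {w. set w \<subseteq> {1..n} \<times> UNIV \<and> length w = n}"
  proof
    fix w assume "w \<in> overlined_perms n"
    then have s: "set (map fst w) = {1..n}" and d: "distinct (map fst w)"
      by (simp_all only: overlined_perms_def permutations_of_set_def mem_Collect_eq)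
    from distinct_card[OF d] have "length w = n"
      by (simp only: s card_atLeastAtMost length_map diff_Suc_1 One_nat_def)
    moreover have "fst x \<in> {1..n}" if "x \<in> set w" for x
      using that s by (metis imageI set_map)
    ultimately show "w \<in> {w. set w \<subseteq> {1..n} \<times> UNIV \<and> length w = n}"
      by (auto simp: mem_Times_iff)
  qed
  show "finite {w::entry list. set w \<subseteq> {1..n} \<times> UNIV \<and> length w = n}"
    by (rule finite_lists_length_eq) simp
qed

lemma finite_inversions: "finite (inversions w)"
  by (rule finite_subset[of _ "{..<length w} \<times> {..<length w}"]) (auto simp: inversions_def)

lemma finite_bounded_overpartitions:
  "finite {p. overpartition p \<and> length p = k \<and> (\<forall>x\<in>set p. fst x \<le> m)}"
proof (rule finite_subset)
  show "{p. overpartition p \<and> length p = k \<and> (\<forall>x\<in>set p. fst x \<le> m)}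
      \<subseteq> {p. set p \<subseteq> {..m} \<times> UNIV \<and> length p = k}"
    by auto
  show "finite {p::entry list. set p \<subseteq> {..m} \<times> UNIV \<and> length p = k}"
    by (rule finite_lists_length_eq) simp
qed

end

theory Submission
  imports Defs
begin

text \<open>
  Both families are built by the same sequence of independent choices. Call a pair of a number
  \<open>c \<le> m\<close> and a flag \<open>b\<close> that can be set only if \<open>c > 0\<close> a choice at level \<open>m\<close>.

  Every element of \<open>B'\<close> on \<open>{1..m+1}\<close> arises from exactly one element on \<open>{1..m}\<close> by inserting the
  entry \<open>m+1\<close> with exactly \<open>c \<le> m\<close> entries to its right. Since \<open>m+1\<close> exceeds all
  other entries, it creates \<open>c\<close> new inversions, it can be overlined iff \<open>c > 0\<close>, and it does not
  affect which of the other entries can be overlined (\<open>bij_insert_max\<close>).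

  For \<open>m > 0\<close>, every overpartition of the restricted kind with parts at most \<open>m\<close> arises
  from exactly one with parts at most \<open>m-1\<close> by putting a block of \<open>c \<le> m\<close> copies of \<open>m\<close> in front, the first of which
  is overlined or not; again the flag is free iff \<open>c > 0\<close>, and \<open>c\<close> parts are added
  (\<open>bij_prepend_block\<close>). The bound in the theorem, \<open>j\<close> or \<open>j-1\<close> for the non-overlined parts, says
  precisely that \<open>j\<close> occurs at most \<open>j\<close> times with the overlined copy included.

  The single entry of a permutation of \<open>{1}\<close> carries a forced choice (level \<open>0\<close>). The remaining
  choices, at levels \<open>1, \<dots>, n-1\<close>, are common to both sides, so matching them level by level gives
  a bijection that turns inversions into parts. In terms of generating functions, both sides are
  \<open>\<Prod>j=1..n-1. (1 + 2q + \<dots> + 2q^j)\<close>.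
\<close>

definition choices :: "nat \<Rightarrow> (nat \<times> bool) set" where
  "choices m = {(c, b). c \<le> m \<and> (b \<longrightarrow> c > 0)}"

section \<open>Inserting the maximum into an overlined permutation\<close>

text \<open>A recursive form of the condition on overlines, suited to induction along the word.\<close>

fun legal_overlines :: "entry list \<Rightarrow> bool" where
  "legal_overlines [] \<longleftrightarrow> True"
| "legal_overlines (x # w) \<longleftrightarrow> (snd x \<longrightarrow> (\<exists>y\<in>set w. fst y < fst x)) \<and> legal_overlines w"

lemma legal_overlines_iff:
  "legal_overlines w \<longleftrightarrow>
     (\<forall>i<length w. snd (w ! i) \<longrightarrow> (\<exists>j. i < j \<and> j < length w \<and> fst (w ! i) > fst (w ! j)))"
proof (induction w)
  case (Cons x w)
  have head: "(\<exists>j>0. j < length (x # w) \<and> fst x > fst ((x # w) ! j)) \<longleftrightarrow>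
      (\<exists>y\<in>set w. fst y < fst x)"
    (is "?L \<longleftrightarrow> ?R")
  proof
    assume ?L
    then obtain i where "i < length w" "fst (w ! i) < fst x"
      by (auto simp: gr0_conv_Suc)
    then show ?R
      by (meson nth_mem)
  next
    assume ?R
    then obtain i where "i < length w" "fst (w ! i) < fst x"
      by (metis in_set_conv_nth)
    then show ?L
      by (intro exI[of _ "Suc i"]) simp
  qed
  have tail: "(\<exists>j>Suc i. j < length (x # w) \<and> fst (w ! i) > fst ((x # w) ! j)) \<longleftrightarrow>
      (\<exists>j>i. j < length w \<and> fst (w ! i) > fst (w ! j))" for i
    by (auto simp: Suc_less_eq2)
  show ?case
    by (simp only: legal_overlines.simps Cons.IH length_Cons All_less_Suc2 nth_Cons_0 nth_Cons_Suc
        head[unfolded length_Cons] tail[unfolded length_Cons])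
qed simp

lemma overlined_perms_iff:
  "w \<in> overlined_perms n \<longleftrightarrow> set (map fst w) = {1..n} \<and> distinct (map fst w) \<and> legal_overlines w"
  by (auto simp: overlined_perms_def legal_overlines_iff permutations_of_set_def)

lemma length_overlined_perm:
  assumes "w \<in> overlined_perms n"
  shows "length w = n"
  using assms distinct_card[of "map fst w"] by (simp add: overlined_perms_iff)

lemma card_inversions_Cons:
  "card (inversions (x # w)) = length (filter (\<lambda>y. fst y < fst x) w) + card (inversions w)"
proof -
  let ?J = "{j. j < length w \<and> fst (w ! j) < fst x}"
  let ?S = "\<lambda>(i, j). (Suc i, Suc j)"
  have "inversions (x # w) = (\<lambda>j. (0, Suc j)) ` ?J \<union> ?S ` inversions w" (is "_ = ?R")
  proof (rule set_eqI, clarify)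
    fix i j
    show "(i, j) \<in> inversions (x # w) \<longleftrightarrow> (i, j) \<in> ?R"
      by (cases i; cases j) (force simp: inversions_def image_iff)+
  qed
  moreover have "card ((\<lambda>j. (0::nat, Suc j)) ` ?J) = card ?J"
    by (rule card_image) (auto simp: inj_on_def)
  moreover have "card (?S ` inversions w) = card (inversions w)"
    by (rule card_image) (auto simp: inj_on_def)
  moreover have "(\<lambda>j. (0, Suc j)) ` ?J \<inter> ?S ` inversions w = {}"
    by auto
  ultimately show ?thesis
    by (simp add: card_Un_disjoint finite_inversions length_filter_conv_card)
qed

text \<open>The maximum forms an inversion with every entry to its right and with none to its left.\<close>

lemma card_inversions_insert_max:
  assumes "\<forall>x\<in>set (u @ v). fst x < N"
  shows "card (inversions (u @ (N, b) # v)) = card (inversions (u @ v)) + length v"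
  using assms by (induction u) (auto simp: card_inversions_Cons)

text \<open>Whether an entry can be overlined depends on the smaller entries to its right, and the maximum
  is never among these; the maximum itself exceeds whatever follows it.\<close>

lemma legal_overlines_insert_max:
  assumes "\<forall>x\<in>set (u @ v). fst x < N"
  shows "legal_overlines (u @ (N, b) # v) \<longleftrightarrow> legal_overlines (u @ v) \<and> (b \<longrightarrow> v \<noteq> [])"
  using assms
proof (induction u)
  case Nil
  then show ?case by (cases v) auto
next
  case (Cons x u)
  then show ?case by auto
qed

text \<open>The number \<open>c\<close> counts the entries to the right of the inserted one, because these are the
  new inversions.\<close>

definition insert_max :: "nat \<Rightarrow> entry list \<times> nat \<times> bool \<Rightarrow> entry list" where
  "insert_max n = (\<lambda>(w, c, b). take (n - c) w @ (Suc n, b) # drop (n - c) w)"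

lemma overlined_perms_insert_max_iff:
  assumes "\<forall>x\<in>set (u @ v). fst x < Suc n"
  shows "u @ (Suc n, b) # v \<in> overlined_perms (Suc n) \<longleftrightarrow>
    u @ v \<in> overlined_perms n \<and> (b \<longrightarrow> v \<noteq> [])"
proof -
  have "\<forall>y\<in>set (map fst (u @ v)). y < Suc n"
    using assms by (simp only: set_map ball_simps)
  then have notin: "Suc n \<notin> set (map fst (u @ v))"
    by (metis less_irrefl)
  have "{1..Suc n} = insert (Suc n) {1..n}"
    by auto
  with notin have "set (map fst (u @ (Suc n, b) # v)) = {1..Suc n} \<longleftrightarrow>
      set (map fst (u @ v)) = {1..n}"
    by (simp add: insert_ident)
  then show ?thesis
    using assms legal_overlines_insert_max[OF assms, of b] notin
    unfolding overlined_perms_iff by auto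
qed

lemma overlined_perm_less_Suc:
  assumes "w \<in> overlined_perms n" and "x \<in> set w"
  shows "fst x < Suc n"
proof -
  have "fst x \<in> set (map fst w)"
    using assms(2) by simp
  then have "fst x \<in> {1..n}"
    using assms(1) by (simp only: overlined_perms_iff)
  then show ?thesis by simp
qed

lemma card_inversions_insert_max_choice:
  assumes "w \<in> overlined_perms n" and "(c, b) \<in> choices n"
  shows "card (inversions (insert_max n (w, c, b))) = card (inversions w) + c"
  using assms card_inversions_insert_max[of "take (n - c) w" "drop (n - c) w" "Suc n" b]
    overlined_perm_less_Suc[OF assms(1)] length_overlined_perm[OF assms(1)]
  by (simp add: insert_max_def choices_def flip: set_append)

lemma bij_insert_max:
  "bij_betw (insert_max n) (overlined_perms n \<times> choices n) (overlined_perms (Suc n))"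
  unfolding bij_betw_def
proof (intro conjI subset_antisym subsetI)
  show "inj_on (insert_max n) (overlined_perms n \<times> choices n)"
  proof (rule inj_onI, clarify)
    fix w c b w' c' b'
    assume w: "w \<in> overlined_perms n" "(c, b) \<in> choices n"
      and w': "w' \<in> overlined_perms n" "(c', b') \<in> choices n"
      and eq: "insert_max n (w, c, b) = insert_max n (w', c', b')"
    have notin: "(Suc n, d) \<notin> set w" "(Suc n, d) \<notin> set w'" for d
      using overlined_perm_less_Suc w(1) w'(1) by fastforce+
    \<comment> \<open>The inserted entry is the only one with value \<open>Suc n\<close>, so it determines the flag, and then
      its position determines \<open>c\<close>.\<close>
    have "(Suc n, b) \<in> set (insert_max n (w', c', b'))"
      unfolding eq[symmetric] by (simp add: insert_max_def)
    then have b: "b = b'"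
      using notin by (auto simp: insert_max_def dest: in_set_takeD in_set_dropD)
    have "take (n - c) w @ (Suc n, b) # drop (n - c) w =
        take (n - c') w' @ (Suc n, b) # drop (n - c') w'"
      using eq by (simp add: insert_max_def b)
    moreover have notin': "(Suc n, b) \<notin> set (take (n - c) w)" "(Suc n, b) \<notin> set (drop (n - c) w)"
      using notin(1) by (meson in_set_takeD, meson in_set_dropD)
    ultimately have "take (n - c) w = take (n - c') w' \<and> drop (n - c) w = drop (n - c') w'"
      by (simp only: append_Cons_eq_iff[OF notin'])
    then have "w = w'" "n - (n - c) = n - (n - c')"
      using length_overlined_perm[OF w(1)] length_overlined_perm[OF w'(1)]
      by (metis append_take_drop_id, metis length_drop)
    then show "w = w' \<and> (c, b) = (c', b')"
      using b w(2) w'(2) by (simp add: choices_def)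
  qed
next
  fix y assume "y \<in> insert_max n ` (overlined_perms n \<times> choices n)"
  then obtain w c b where w: "w \<in> overlined_perms n" "(c, b) \<in> choices n"
    and y: "y = insert_max n (w, c, b)"
    by auto
  then show "y \<in> overlined_perms (Suc n)"
    using overlined_perms_insert_max_iff[of "take (n - c) w" "drop (n - c) w" n b]
      overlined_perm_less_Suc[OF w(1)] length_overlined_perm[OF w(1)]
    by (auto simp: insert_max_def choices_def simp flip: set_append)
next
  fix y assume y: "y \<in> overlined_perms (Suc n)"
  then have "Suc n \<in> set (map fst y)"
    by (simp add: overlined_perms_iff)
  then obtain b where "(Suc n, b) \<in> set y"
    by auto
  then obtain u v where uv: "y = u @ (Suc n, b) # v"
    by (meson split_list)
  have "\<forall>x\<in>set (u @ v). fst x < Suc n"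
  proof
    fix x assume x: "x \<in> set (u @ v)"
    have "distinct (map fst u @ Suc n # map fst v)"
      using y by (simp add: uv overlined_perms_iff del: set_append set_map)
    then have "Suc n \<notin> fst ` set (u @ v)"
      by auto
    then have "fst x \<noteq> Suc n"
      using x by (metis imageI)
    moreover have "fst x < Suc (Suc n)"
      using overlined_perm_less_Suc[OF y] x uv by auto
    ultimately show "fst x < Suc n" by simp
  qed
  then have w: "u @ v \<in> overlined_perms n" "b \<longrightarrow> v \<noteq> []"
    using y uv overlined_perms_insert_max_iff by auto
  then have "length u + length v = n"
    using length_overlined_perm by fastforce
  then have "y = insert_max n (u @ v, length v, b)" "(length v, b) \<in> choices n"
    using uv w by (auto simp: insert_max_def choices_def)
  then show "y \<in> insert_max n ` (overlined_perms n \<times> choices n)"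
    using w by blast
qed

section \<open>Prepending the block of largest parts to an overpartition\<close>

definition bounded_overpartitions :: "nat \<Rightarrow> entry list set" where
  "bounded_overpartitions m = {p. overpartition p \<and> (\<forall>x\<in>set p. fst x \<le> m) \<and>
     (\<forall>j\<ge>1. count_list p (j, False) \<le> (if (j, True) \<in> set p then j - 1 else j))}"

definition block :: "nat \<Rightarrow> nat \<Rightarrow> bool \<Rightarrow> entry list" where
  "block N c b = (if c = 0 then [] else (N, b) # replicate (c - 1) (N, False))"

definition prepend_block :: "nat \<Rightarrow> entry list \<times> nat \<times> bool \<Rightarrow> entry list" where
  "prepend_block N = (\<lambda>(p, c, b). block N c b @ p)"

lemma overpartition_Nil: "overpartition []"
  by (simp add: overpartition_def)

lemma overpartition_Cons:
  "overpartition (x # p) \<longleftrightarrow> fst x > 0 \<and> (\<forall>y\<in>set p. fst y \<le> fst x) \<and>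
     (\<forall>y\<in>set p. snd y \<longrightarrow> fst y \<noteq> fst x) \<and> overpartition p"
proof -
  have "(\<forall>i<length (x # p). snd ((x # p) ! i) \<longrightarrow> (\<forall>i'<i. fst ((x # p) ! i') \<noteq> fst ((x # p) ! i)))
     \<longleftrightarrow> (\<forall>y\<in>set p. snd y \<longrightarrow> fst y \<noteq> fst x) \<and>
        (\<forall>i<length p. snd (p ! i) \<longrightarrow> (\<forall>i'<i. fst (p ! i') \<noteq> fst (p ! i)))"
    by (auto simp: All_less_Suc2 all_set_conv_all_nth)
  then show ?thesis
    by (auto simp: overpartition_def)
qed

lemma length_block [simp]: "length (block N c b) = c"
  by (simp add: block_def)

lemma fst_in_block: "x \<in> set (block N c b) \<Longrightarrow> fst x = N"
  by (auto simp: block_def split: if_splits)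

lemma count_list_replicate: "count_list (replicate k y) x = (if x = y then k else 0)"
  by (induction k) auto

lemma overpartition_block_append:
  assumes "\<forall>x\<in>set p. fst x < N" and "N > 0"
  shows "overpartition (block N c b @ p) \<longleftrightarrow> overpartition p"
proof -
  have *: "overpartition (replicate k (N, False) @ p) \<longleftrightarrow> overpartition p" for k
    using assms by (induction k) (auto simp: overpartition_Cons)
  show ?thesis
    using assms * by (cases c) (auto simp: block_def overpartition_Cons)
qed

text \<open>In an overpartition, only the first occurrence of the largest part can be overlined.\<close>

lemma overpartition_eq_block_append:
  assumes "overpartition p" and "\<forall>x\<in>set p. fst x \<le> N"
  obtains c b q where "p = block N c b @ q" and "\<forall>x\<in>set q. fst x < N" and "b \<longrightarrow> c > 0"
proof -
  have "\<exists>c b q. p = block N c b @ q \<and> (\<forall>x\<in>set q. fst x < N) \<and> (b \<longrightarrow> c > 0)"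
    using assms
  proof (induction p)
    case Nil
    show ?case by (rule exI[of _ 0], rule exI[of _ False]) (simp add: block_def)
  next
    case (Cons x p)
    then obtain c b q where p: "p = block N c b @ q" and q: "\<forall>x\<in>set q. fst x < N"
      and b: "b \<longrightarrow> c > 0"
      by (auto simp: overpartition_Cons)
    show ?case
    proof (cases "fst x = N")
      case True
      then have "\<not> b"
        using Cons.prems(1) p b by (auto simp: overpartition_Cons block_def)
      then have "block N c b = replicate c (N, False)"
        by (cases c) (auto simp: block_def)
      then have "x # p = block N (Suc c) (snd x) @ q"
        using p True by (simp add: block_def prod_eq_iff)
      then show ?thesis using q by blast
    next
      case False
      then have "\<forall>y\<in>set (x # p). fst y < N"
        using Cons.prems by (fastforce simp: overpartition_Cons)
      then show ?thesis
        by (intro exI[of _ 0] exI[of _ False] exI[of _ "x # p"]) (simp add: block_def)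
    qed
  qed
  then show thesis using that by blast
qed

text \<open>The bound for the part \<open>N\<close> is a bound on the length of its block, whether or not the block
  starts with an overlined part, and the block leaves the multiplicities of all other parts
  unchanged.\<close>

lemma multiplicity_bound_block_append:
  assumes q: "\<forall>x\<in>set q. fst x < N" and "N > 0"
  shows "(\<forall>j\<ge>1. count_list (block N c b @ q) (j, False) \<le>
           (if (j, True) \<in> set (block N c b @ q) then j - 1 else j)) \<longleftrightarrow>
    c \<le> N \<and> (\<forall>j\<ge>1. count_list q (j, False) \<le> (if (j, True) \<in> set q then j - 1 else j))"
    (is "(\<forall>j\<ge>1. ?P j) \<longleftrightarrow> c \<le> N \<and> (\<forall>j\<ge>1. ?Q j)")
proof -
  have notin: "(N, d) \<notin> set q" for d
    using q by auto
  have "?P N \<longleftrightarrow> c \<le> N"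
    using notin \<open>N > 0\<close> by (auto simp: block_def count_list_replicate)
  moreover have "?Q N"
    using notin by simp
  moreover have "?P j \<longleftrightarrow> ?Q j" if "j \<noteq> N" for j
    using that by (auto simp: block_def count_list_replicate)
  ultimately show ?thesis
    using \<open>N > 0\<close> by (metis One_nat_def Suc_leI)
qed

lemma bounded_overpartitions_block_append_iff:
  assumes "\<forall>x\<in>set q. fst x < Suc m"
  shows "block (Suc m) c b @ q \<in> bounded_overpartitions (Suc m) \<longleftrightarrow>
    c \<le> Suc m \<and> q \<in> bounded_overpartitions m"
proof -
  have "\<forall>x\<in>set (block (Suc m) c b @ q). fst x \<le> Suc m"
    using assms fst_in_block by fastforce
  moreover have "\<forall>x\<in>set q. fst x \<le> m"
    using assms by auto
  ultimately show ?thesis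
    using overpartition_block_append[OF assms, of c b]
      multiplicity_bound_block_append[OF assms, of c b]
    unfolding bounded_overpartitions_def by blast
qed

lemma bounded_overpartition_less_Suc:
  "p \<in> bounded_overpartitions m \<Longrightarrow> \<forall>x\<in>set p. fst x < Suc m"
  by (auto simp: bounded_overpartitions_def)

lemma bij_prepend_block:
  "bij_betw (prepend_block (Suc m)) (bounded_overpartitions m \<times> choices (Suc m))
     (bounded_overpartitions (Suc m))"
  unfolding bij_betw_def
proof (intro conjI subset_antisym subsetI)
  let ?N = "Suc m"
  show "inj_on (prepend_block ?N) (bounded_overpartitions m \<times> choices ?N)"
  proof (rule inj_onI, clarify)
    fix p c b p' c' b'
    assume p: "p \<in> bounded_overpartitions m" "(c, b) \<in> choices ?N"
      and p': "p' \<in> bounded_overpartitions m" "(c', b') \<in> choices ?N"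
      and eq: "prepend_block ?N (p, c, b) = prepend_block ?N (p', c', b')"
    \<comment> \<open>The block is recovered as the list of all parts equal to \<open>Suc m\<close>.\<close>
    have filter: "filter (\<lambda>x. fst x = ?N) (prepend_block ?N (q, d, e)) = block ?N d e"
      if "q \<in> bounded_overpartitions m" for q d e
    proof -
      have "filter (\<lambda>x. fst x = ?N) (block ?N d e) = block ?N d e"
        by (simp add: filter_id_conv fst_in_block)
      moreover have "filter (\<lambda>x. fst x = ?N) q = []"
        using bounded_overpartition_less_Suc[OF that] by (fastforce simp: filter_empty_conv)
      ultimately show ?thesis
        by (simp add: prepend_block_def)
    qed
    have block: "block ?N c b = block ?N c' b'"
      using filter p(1) p'(1) eq by metis
    then have c: "c = c'"
      by (metis length_block)
    then have "b = b'"
      using block p(2) p'(2) by (cases "c = 0") (auto simp: block_def choices_def)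
    moreover have "p = p'"
      using eq block by (simp add: prepend_block_def)
    ultimately show "p = p' \<and> (c, b) = (c', b')"
      using c by simp
  qed
next
  fix y assume "y \<in> prepend_block (Suc m) ` (bounded_overpartitions m \<times> choices (Suc m))"
  then show "y \<in> bounded_overpartitions (Suc m)"
    using bounded_overpartitions_block_append_iff[OF bounded_overpartition_less_Suc]
    by (auto simp: prepend_block_def choices_def)
next
  fix y assume y: "y \<in> bounded_overpartitions (Suc m)"
  then obtain c b q where yq: "y = block (Suc m) c b @ q" "\<forall>x\<in>set q. fst x < Suc m" "b \<longrightarrow> c > 0"
    using overpartition_eq_block_append[of y "Suc m"] by (auto simp: bounded_overpartitions_def)
  then have "q \<in> bounded_overpartitions m" "(c, b) \<in> choices (Suc m)"
    using y bounded_overpartitions_block_append_iff by (auto simp: choices_def)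
  then show "y \<in> prepend_block (Suc m) ` (bounded_overpartitions m \<times> choices (Suc m))"
    using yq(1) by (force simp: prepend_block_def)
qed

section \<open>The bijection between overlined permutations and overpartitions\<close>

lemma overlined_perms_1: "overlined_perms (Suc 0) = {[(1, False)]}"
proof -
  have "overlined_perms 0 = {[]}"
    by (auto simp: overlined_perms_iff)
  moreover have "choices 0 = {(0, False)}"
    by (auto simp: choices_def)
  ultimately show ?thesis
    using bij_betw_imp_surj_on[OF bij_insert_max[of 0]] by (simp add: insert_max_def)
qed

lemma bounded_overpartitions_0: "bounded_overpartitions 0 = {[]}"
proof -
  have "p = []" if "p \<in> bounded_overpartitions 0" for p
    using that by (cases p) (auto simp: bounded_overpartitions_def overpartition_Cons)
  then show ?thesis
    by (auto simp: bounded_overpartitions_def overpartition_Nil)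
qed

text \<open>The indices differ by one because inserting \<open>m + 1\<close> into a permutation of \<open>{1..m}\<close> offers the
  same choices as prepending a block of parts \<open>m\<close>.\<close>

lemma inversions_to_parts_bijection:
  "\<exists>f. bij_betw f (overlined_perms (Suc m)) (bounded_overpartitions m) \<and>
       (\<forall>w\<in>overlined_perms (Suc m). length (f w) = card (inversions w))"
proof (induction m)
  case 0
  have "inversions [(1, False)] = {}"
    by (auto simp: inversions_def)
  then show ?case
    by (intro exI[of _ "\<lambda>_. []"]) (simp add: overlined_perms_1 bounded_overpartitions_0 bij_betw_def)
next
  case (Suc m)
  let ?N = "Suc m"
  let ?A = "overlined_perms ?N \<times> choices ?N"
  obtain f where f: "bij_betw f (overlined_perms ?N) (bounded_overpartitions m)"
    and len: "\<And>w. w \<in> overlined_perms ?N \<Longrightarrow> length (f w) = card (inversions w)"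
    using Suc.IH by blast
  define g where "g = prepend_block ?N \<circ> map_prod f id \<circ> inv_into ?A (insert_max ?N)"
  have "bij_betw g (overlined_perms (Suc ?N)) (bounded_overpartitions ?N)"
    unfolding g_def
    by (rule bij_betw_trans[OF bij_betw_inv_into[OF bij_insert_max]
          bij_betw_trans[OF bij_betw_map_prod[OF f bij_betw_id] bij_prepend_block],
          folded comp_assoc])
  moreover have "length (g w) = card (inversions w)" if w: "w \<in> overlined_perms (Suc ?N)" for w
  proof -
    have "w \<in> insert_max ?N ` ?A"
      unfolding bij_betw_imp_surj_on[OF bij_insert_max] by (rule w)
    then obtain z where z: "z \<in> ?A" "w = insert_max ?N z"
      by (rule imageE)
    obtain v c b where "z = (v, c, b)"
      by (metis surj_pair)
    with z have v: "v \<in> overlined_perms ?N" "(c, b) \<in> choices ?N"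
      and eq: "w = insert_max ?N (v, c, b)"
      by auto
    have "inv_into ?A (insert_max ?N) w = (v, c, b)"
      unfolding eq using v by (intro bij_betw_inv_into_left[OF bij_insert_max]) simp
    then show ?thesis
      using len[OF v(1)] card_inversions_insert_max_choice[OF v]
      by (simp add: g_def prepend_block_def eq)
  qed
  ultimately show ?case by blast
qed

theorem theorem3p4:
  fixes n k :: nat
  assumes "n \<ge> 1"
  shows "over_mahonian n k =
    card {p. overpartition p \<and> length p = k \<and> (\<forall>x\<in>set p. fst x \<le> n - 1) \<and>
             (\<forall>j\<ge>1. count_list p (j, False) \<le> (if (j, True) \<in> set p then j - 1 else j))}"
    (is "_ = card ?P")
proof -
  obtain m where n: "n = Suc m"
    using assms by (cases n) auto
  obtain f where f: "bij_betw f (overlined_perms n) (bounded_overpartitions m)"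
    and len: "\<And>w. w \<in> overlined_perms n \<Longrightarrow> length (f w) = card (inversions w)"
    using inversions_to_parts_bijection[of m] n by blast
  have img: "\<exists>w\<in>overlined_perms n. p = f w" if "p \<in> bounded_overpartitions m" for p
    using that bij_betw_imp_surj_on[OF f] by blast
  have "f ` {w \<in> overlined_perms n. card (inversions w) = k} =
      {p \<in> bounded_overpartitions m. length p = k}"
  proof (intro subset_antisym subsetI)
    fix p assume "p \<in> {p \<in> bounded_overpartitions m. length p = k}"
    then show "p \<in> f ` {w \<in> overlined_perms n. card (inversions w) = k}"
      using img[of p] len by fastforce
  qed (use len bij_betwE[OF f] in auto)
  then have "bij_betw f {w \<in> overlined_perms n. card (inversions w) = k}
      {p \<in> bounded_overpartitions m. length p = k}"
    by (intro bij_betw_subset[OF f]) auto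
  then have "over_mahonian n k = card {p \<in> bounded_overpartitions m. length p = k}"
    unfolding over_mahonian_def by (rule bij_betw_same_card)
  also have "{p \<in> bounded_overpartitions m. length p = k} = ?P"
    by (auto simp: bounded_overpartitions_def n)
  finally show ?thesis .
qed

end
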